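(* Let $n\ge 1$ and let $U_1,U_2\in\mathbb{C}_{n\times n}$ be unitary matrices. Then there exist unitary matrices $A_1,A_2\in\mathbb{C}_{n\times n}$ with $[A_1,A_2]=0$ such that $$\|U_1-A_1\|_{tr}\le 30\left(\|[U_1,U_2]\|_{tr}\right)^{1/9}\quad\text{and}\quad \|U_2-A_2\|_{tr}\le 30\left(\|[U_1,U_2]\|_{tr}\right)^{1/9}.$$ In addition, $A_1$ can be chosen so that also $[A_1,U_1]=0$ (i.e. a single pair $A_1,A_2$ satisfies all of these properties).
   Context: $\mathbb{C}_{n\times n}$ is the set of complex $n\times n$ matrices, $[X,Y]=XY-YX$, and $\|A\|_{tr}=\sqrt{\frac1n\sum_{j,k=1}^n|A_{j,k}|^2}$ is the normalized Hilbert-Schmidt norm on $\mathbb{C}_{n\times n}$. *)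

theory Defs
  imports "HOL-Analysis.Analysis"
begin

definition conj_transpose :: "complex^'n^'m \<Rightarrow> complex^'m^'n" where
  "conj_transpose A = (\<chi> i j. cnj (A $ j $ i))"

definition unitary_matrix :: "complex^'n^'n \<Rightarrow> bool" where
  "unitary_matrix U \<longleftrightarrow> conj_transpose U ** U = mat 1 \<and> U ** conj_transpose U = mat 1"

definition commutator :: "complex^'n^'n \<Rightarrow> complex^'n^'n \<Rightarrow> complex^'n^'n" where
  "commutator X Y = X ** Y - Y ** X"

definition norm_tr :: "complex^'n^'n \<Rightarrow> real" where
  "norm_tr A = sqrt (1 / real CARD('n) * (\<Sum>j\<in>UNIV. \<Sum>k\<in>UNIV. (cmod (A $ j $ k))\<^sup>2))"

end

theory Submission
  imports Defs "HOL-Computational_Algebra.Fundamental_Theorem_Algebra"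
begin

text \<open>
  In an eigenbasis of \<open>U\<^sub>1\<close>, with eigenvalues \<open>\<mu>\<^sub>i\<close>, the squared Frobenius norm of the
  commutator is the sum of \<open>|\<mu>\<^sub>i - \<mu>\<^sub>j|\<^sup>2 |u\<^sub>i\<^sub>j|\<^sup>2\<close>, where \<open>u\<close> represents \<open>U\<^sub>2\<close>. Cut the plane
  into squares of side \<open>L\<close>. Averaging over shifts of the grid, the entries \<open>u\<^sub>i\<^sub>j\<close> with \<open>\<mu>\<^sub>i\<close> and \<open>\<mu>\<^sub>j\<close>
  in different squares carry a proportion \<open>O(\<epsilon>/L)\<close> of the mass of \<open>u\<close>, where \<open>\<epsilon>\<close> is the
  normalized norm of the commutator. Let \<open>A\<^sub>1\<close> be \<open>U\<^sub>1\<close> with the eigenvalues in each square replaced by a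
  single one of them, and \<open>A\<^sub>2\<close> the unitary polar factor of the part \<open>X\<close> of \<open>u\<close> that is block diagonal
  with respect to the squares (slightly perturbed to be invertible). No unitary matrix is closer to \<open>X\<close>
  than its polar factor, so \<open>A\<^sub>2\<close> is at most twice as far from \<open>u\<close> as \<open>X\<close>. The choice
  \<open>L = \<epsilon>\<^bsup>1/3\<^esup>\<close> gives a bound of order \<open>\<epsilon>\<^bsup>1/3\<^esup>\<close>, which suffices because \<open>\<epsilon> \<le> 2\<close>.
\<close>

section \<open>Unitary and diagonal matrices\<close>

lemma conj_transpose_nth [simp]: "conj_transpose A $ i $ j = cnj (A $ j $ i)"
  by (simp add: conj_transpose_def)

lemma conj_transpose_conj_transpose [simp]: "conj_transpose (conj_transpose A) = A"
  by (simp add: vec_eq_iff)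

lemma conj_transpose_mult: "conj_transpose (A ** B) = conj_transpose B ** conj_transpose A"
  by (simp add: vec_eq_iff matrix_matrix_mult_def mult.commute)

lemma matrix_diff_ldistrib: "A ** (B - C) = A ** B - A ** C"
  for A :: "'a::ring_1^'n^'m"
  by (simp add: vec_eq_iff matrix_matrix_mult_def algebra_simps sum_subtractf)

lemma matrix_diff_rdistrib: "(A - B) ** C = A ** C - B ** C"
  for C :: "'a::ring_1^'n^'m"
  by (simp add: vec_eq_iff matrix_matrix_mult_def algebra_simps sum_subtractf)

lemma mat_mult_nth [simp]: "(mat z ** A) $ i $ j = z * A $ i $ j"
  by (simp add: matrix_matrix_mult_def mat_def if_distrib[of "\<lambda>x. x * _"] sum.delta cong: if_cong)

lemma mult_mat_nth [simp]: "(A ** mat z) $ i $ j = A $ i $ j * z"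
  by (simp add: matrix_matrix_mult_def mat_def if_distrib[of "\<lambda>x. _ * x"] sum.delta' cong: if_cong)

lemma mat_vector_mult: "mat z *v x = z *s x"
  by (simp add: vec_eq_iff matrix_vector_mult_def mat_def if_distrib[of "\<lambda>x. x * _"] sum.delta
      cong: if_cong)

lemma unitary_matrixI: "conj_transpose U ** U = mat 1 \<Longrightarrow> unitary_matrix U"
  by (simp add: unitary_matrix_def matrix_left_right_inverse)

lemma unitary_matrixD:
  assumes "unitary_matrix U"
  shows "conj_transpose U ** U = mat 1" "U ** conj_transpose U = mat 1"
  using assms by (auto simp: unitary_matrix_def)

lemma unitary_matrix_conj_transpose: "unitary_matrix U \<Longrightarrow> unitary_matrix (conj_transpose U)"
  by (simp add: unitary_matrix_def)

lemma unitary_matrix_mult: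
  assumes "unitary_matrix U" "unitary_matrix V"
  shows "unitary_matrix (U ** V)"
proof (rule unitary_matrixI)
  have "conj_transpose (U ** V) ** (U ** V) = conj_transpose V ** (conj_transpose U ** U) ** V"
    by (simp add: conj_transpose_mult matrix_mul_assoc)
  then show "conj_transpose (U ** V) ** (U ** V) = mat 1"
    using assms by (simp add: unitary_matrixD)
qed

lemma det_unitary_nonzero: "unitary_matrix U \<Longrightarrow> det U \<noteq> 0"
  by (metis unitary_matrix_def invertible_def invertible_det_nz)

definition cdiag :: "('n \<Rightarrow> complex) \<Rightarrow> complex^'n^'n" where
  "cdiag d = (\<chi> i j. if i = j then d i else 0)"

lemma cdiag_mult_nth [simp]: "(cdiag d ** A) $ i $ j = d i * A $ i $ j"
  by (simp add: cdiag_def matrix_matrix_mult_def if_distrib[of "\<lambda>x. x * _"] sum.delta cong: if_cong)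

lemma mult_cdiag_nth [simp]: "(A ** cdiag d) $ i $ j = A $ i $ j * d j"
  by (simp add: cdiag_def matrix_matrix_mult_def if_distrib[of "\<lambda>x. _ * x"] sum.delta' cong: if_cong)

lemma cdiag_mult: "cdiag d ** cdiag f = cdiag (\<lambda>i. d i * f i)"
  by (simp add: vec_eq_iff) (simp add: cdiag_def)

lemma cdiag_diff: "cdiag d - cdiag f = cdiag (\<lambda>i. d i - f i)"
  by (simp add: vec_eq_iff cdiag_def)

lemma conj_transpose_cdiag: "conj_transpose (cdiag d) = cdiag (\<lambda>i. cnj (d i))"
  by (simp add: vec_eq_iff cdiag_def)

lemma cdiag_eq_mat_1_iff: "cdiag d = mat 1 \<longleftrightarrow> (\<forall>i. d i = 1)"
  by (auto simp: vec_eq_iff cdiag_def mat_def)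

lemma unitary_matrix_cdiag_iff: "unitary_matrix (cdiag d) \<longleftrightarrow> (\<forall>i. cmod (d i) = 1)"
proof -
  have "z * cnj z = 1 \<longleftrightarrow> cmod z = 1" for z
    by (simp add: abs_square_eq_1 flip: complex_norm_square of_real_power)
  then show ?thesis
    by (simp add: unitary_matrix_def conj_transpose_cdiag cdiag_mult cdiag_eq_mat_1_iff mult.commute)
qed

lemma commutes_cdiag_cong:
  assumes "C ** cdiag d = cdiag d ** C" and "\<And>i j. d i = d j \<Longrightarrow> f i = f j"
  shows "C ** cdiag f = cdiag f ** C"
proof -
  have "C $ i $ j * f j = f i * C $ i $ j" for i j
  proof (cases "d i = d j")
    case False
    have "(C ** cdiag d) $ i $ j = (cdiag d ** C) $ i $ j" using assms(1) by simp
    then have "C $ i $ j = 0" using False by (simp add: mult.commute)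
    then show ?thesis by simp
  qed (use assms(2)[of i j] in simp)
  then show ?thesis by (simp add: vec_eq_iff)
qed

definition conjugate_by :: "complex^'n^'n \<Rightarrow> complex^'n^'n \<Rightarrow> complex^'n^'n" where
  "conjugate_by V A = V ** A ** conj_transpose V"

lemma conj_transpose_conjugate_by:
  "conj_transpose (conjugate_by V A) = conjugate_by V (conj_transpose A)"
  by (simp add: conjugate_by_def conj_transpose_mult matrix_mul_assoc)

lemma conjugate_by_diff: "conjugate_by V (A - B) = conjugate_by V A - conjugate_by V B"
  by (simp add: conjugate_by_def matrix_diff_ldistrib matrix_diff_rdistrib)

lemma conjugate_by_mult:
  assumes "unitary_matrix V"
  shows "conjugate_by V (A ** B) = conjugate_by V A ** conjugate_by V B"
  unfolding conjugate_by_def by (metis assms unitary_matrixD(1) matrix_mul_assoc matrix_mul_rid)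

lemma conjugate_by_mat_1: "unitary_matrix V \<Longrightarrow> conjugate_by V (mat 1) = mat 1"
  by (simp add: conjugate_by_def unitary_matrixD)

lemma conjugate_by_conj_transpose_cancel:
  assumes "unitary_matrix V"
  shows "conjugate_by V (conjugate_by (conj_transpose V) A) = A"
  unfolding conjugate_by_def
  by (metis assms unitary_matrixD(2) conj_transpose_conj_transpose matrix_mul_assoc
      matrix_mul_lid matrix_mul_rid)

lemma conjugate_by_mult_right: "unitary_matrix V \<Longrightarrow> conjugate_by V A ** V = V ** A"
  unfolding conjugate_by_def by (metis unitary_matrixD(1) matrix_mul_assoc matrix_mul_rid)

lemma conjugate_by_eq_iff: "unitary_matrix V \<Longrightarrow> conjugate_by V A = conjugate_by V B \<longleftrightarrow> A = B"
  by (metis conjugate_by_conj_transpose_cancel conj_transpose_conj_transpose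
      unitary_matrix_conj_transpose)

lemma conjugate_by_eq_0_iff: "unitary_matrix V \<Longrightarrow> conjugate_by V A = 0 \<longleftrightarrow> A = 0"
  using conjugate_by_eq_iff[of V A 0] conjugate_by_diff[of V 0 0] by simp

lemma unitary_matrix_conjugate_by_iff:
  assumes "unitary_matrix V"
  shows "unitary_matrix (conjugate_by V A) \<longleftrightarrow> unitary_matrix A"
  using conjugate_by_eq_iff[OF assms, of _ "mat 1"]
  by (simp add: unitary_matrix_def conj_transpose_conjugate_by conjugate_by_mat_1[OF assms]
      flip: conjugate_by_mult[OF assms])

lemma commutator_conjugate_by:
  assumes "unitary_matrix V"
  shows "commutator (conjugate_by V A) (conjugate_by V B) = conjugate_by V (commutator A B)"
  by (simp add: commutator_def conjugate_by_diff conjugate_by_mult assms)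

lemma commutes_conjugate_by_cdiag_cong:
  assumes unitary_V: "unitary_matrix V"
    and comm: "C ** conjugate_by V (cdiag d) = conjugate_by V (cdiag d) ** C"
    and level_sets: "\<And>i j. d i = d j \<Longrightarrow> f i = f j"
  shows "C ** conjugate_by V (cdiag f) = conjugate_by V (cdiag f) ** C"
proof -
  define D where "D = conjugate_by (conj_transpose V) C"
  have C_eq: "C = conjugate_by V D"
    by (simp add: D_def conjugate_by_conj_transpose_cancel unitary_V)
  have "D ** cdiag d = cdiag d ** D"
    using comm by (simp add: C_eq conjugate_by_eq_iff unitary_V flip: conjugate_by_mult)
  then have "D ** cdiag f = cdiag f ** D"
    by (rule commutes_cdiag_cong) (rule level_sets)
  then show ?thesis by (simp add: C_eq unitary_V flip: conjugate_by_mult)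
qed

section \<open>The Frobenius norm\<close>

lemma norm_matrix_eq_L2_set: "norm A = L2_set (\<lambda>(i, j). cmod (A $ i $ j)) UNIV"
  for A :: "complex^'n^'m"
  by (simp add: norm_vec_def L2_set_def sum_nonneg sum.cartesian_product case_prod_unfold
      flip: UNIV_Times_UNIV)

lemma norm_matrix_power2: "(norm A)\<^sup>2 = (\<Sum>i\<in>UNIV. \<Sum>j\<in>UNIV. (cmod (A $ i $ j))\<^sup>2)"
  for A :: "complex^'n^'m"
  by (simp add: norm_vec_def L2_set_def sum_nonneg)

lemma norm_matrix_power2_columns: "(norm A)\<^sup>2 = (\<Sum>j\<in>UNIV. (norm (column j A))\<^sup>2)"
  for A :: "complex^'n^'m"
  by (subst norm_matrix_power2, subst sum.swap)
    (simp add: norm_vec_def L2_set_def sum_nonneg column_def)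

lemma norm_conj_transpose [simp]: "norm (conj_transpose A) = norm A"
proof -
  have "(norm (conj_transpose A))\<^sup>2 = (norm A)\<^sup>2"
    unfolding norm_matrix_power2 by (subst sum.swap) simp
  then show ?thesis by simp
qed

lemma of_real_norm_matrix_power2:
  "complex_of_real ((norm A)\<^sup>2) = trace (A ** conj_transpose A)" for A :: "complex^'n^'m"
  by (simp add: norm_matrix_power2 trace_def matrix_matrix_mult_def complex_norm_square
      del: of_real_power)

lemma norm_mult_unitary_right:
  assumes "unitary_matrix U"
  shows "norm (A ** U) = norm A"
proof -
  have "(A ** U) ** conj_transpose (A ** U) = A ** (U ** conj_transpose U) ** conj_transpose A"
    by (simp add: conj_transpose_mult matrix_mul_assoc)
  also have "\<dots> = A ** conj_transpose A"
    using assms by (simp add: unitary_matrixD)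
  finally have "complex_of_real ((norm (A ** U))\<^sup>2) = complex_of_real ((norm A)\<^sup>2)"
    by (simp only: of_real_norm_matrix_power2)
  then show ?thesis by (simp only: of_real_eq_iff power2_eq_iff_nonneg norm_ge_zero)
qed

lemma norm_mult_unitary_left: "unitary_matrix U \<Longrightarrow> norm (U ** A) = norm A"
  by (metis conj_transpose_mult norm_conj_transpose norm_mult_unitary_right
      unitary_matrix_conj_transpose)

lemma norm_conjugate_by: "unitary_matrix V \<Longrightarrow> norm (conjugate_by V A) = norm A"
  by (simp add: conjugate_by_def norm_mult_unitary_left norm_mult_unitary_right
      unitary_matrix_conj_transpose)

lemma norm_unitary_matrix:
  fixes U :: "complex^'n^'n"
  assumes "unitary_matrix U"
  shows "norm U = sqrt CARD('n)"
proof -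
  have "complex_of_real ((norm U)\<^sup>2) = of_real CARD('n)"
    unfolding of_real_norm_matrix_power2 by (simp add: unitary_matrixD assms trace_def mat_def)
  then have "(norm U)\<^sup>2 = CARD('n)" by (simp only: of_real_eq_iff)
  then show ?thesis by (simp add: real_sqrt_unique)
qed

lemma norm_cdiag_le:
  fixes d :: "'n::finite \<Rightarrow> complex"
  assumes "\<And>i. cmod (d i) \<le> r"
  shows "norm (cdiag d) \<le> r * sqrt CARD('n)"
proof (rule power2_le_imp_le)
  have "0 \<le> r" using norm_ge_zero assms order_trans by blast
  then show "0 \<le> r * sqrt CARD('n)" by simp
  have "(norm (cdiag d))\<^sup>2 = (\<Sum>i\<in>UNIV. (cmod (d i))\<^sup>2)"
    by (simp add: norm_matrix_power2 cdiag_def if_distrib[of "\<lambda>x. (cmod x)\<^sup>2"] sum.delta cong: if_cong)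
  also have "\<dots> \<le> (\<Sum>i\<in>(UNIV :: 'n set). r\<^sup>2)"
    by (intro sum_mono power_mono assms) auto
  finally show "(norm (cdiag d))\<^sup>2 \<le> (r * sqrt CARD('n))\<^sup>2"
    by (simp add: power_mult_distrib mult.commute)
qed

lemma norm_tr_eq: "norm_tr A = norm A / sqrt CARD('n)" for A :: "complex^'n^'n"
  by (simp add: norm_tr_def norm_matrix_power2[symmetric] real_sqrt_divide)

lemma norm_eq_norm_tr: "norm A = norm_tr A * sqrt CARD('n)" for A :: "complex^'n^'n"
  by (simp add: norm_tr_eq)

lemma norm_tr_le_iff: "norm_tr A \<le> r \<longleftrightarrow> norm A \<le> r * sqrt CARD('n)" for A :: "complex^'n^'n"
  by (simp add: norm_tr_eq pos_divide_le_eq)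

lemma norm_tr_conjugate_by: "unitary_matrix V \<Longrightarrow> norm_tr (conjugate_by V A) = norm_tr A"
  by (simp add: norm_tr_eq norm_conjugate_by)

lemma norm_tr_commutator_unitary_le:
  fixes U V :: "complex^'n^'n"
  assumes "unitary_matrix U" "unitary_matrix V"
  shows "norm_tr (commutator U V) \<le> 2"
proof -
  have "norm (commutator U V) \<le> norm (U ** V) + norm (V ** U)"
    unfolding commutator_def by (rule norm_triangle_ineq4)
  also have "\<dots> = 2 * sqrt CARD('n)"
    by (simp add: norm_unitary_matrix unitary_matrix_mult assms)
  finally show ?thesis by (simp add: norm_tr_le_iff)
qed

section \<open>Eigenvectors in invariant subspaces\<close>

lemma exists_poly_det_pencil:
  fixes A B :: "'a::comm_ring_1^'n^'n"
  obtains p where "\<And>t. poly p t = det (A - mat t ** B)"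
proof -
  have "poly (det (\<chi> i j. [:A $ i $ j, - B $ i $ j:])) t = det (A - mat t ** B)" for t
    by (simp add: det_def poly_sum poly_prod)
  then show ?thesis by (rule that)
qed

lemma det_eq_0_iff_kernel: "det A = 0 \<longleftrightarrow> (\<exists>v. v \<noteq> 0 \<and> A *v v = 0)" for A :: "'a::field^'n^'n"
  by (metis invertible_det_nz invertible_left_inverse matrix_left_invertible_ker)

text \<open>Up to sign, the determinant is the characteristic polynomial of the compression of \<open>M\<close> to
  the range of \<open>P\<close>; comparing it with its reversal shows that it is not constant.\<close>

lemma exists_root_det_compression:
  fixes M P :: "complex^'n^'n"
  assumes idem: "P ** P = P" and "P \<noteq> 0"
  obtains z where "det (M ** P + (mat 1 - P) - mat z ** P) = 0"
proof (rule ccontr)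
  assume no_root: "\<not> thesis"
  obtain p where poly_p: "\<And>t. poly p t = det (M ** P + (mat 1 - P) - mat t ** P)"
    using exists_poly_det_pencil by blast
  have "constant (poly p)"
    using no_root that fundamental_theorem_of_algebra poly_p by metis
  then obtain c where p_const: "\<And>z. poly p z = c" unfolding constant_def by metis
  obtain q where poly_q: "\<And>t. poly q t = det (mat 1 - mat t ** (M ** P))"
    using exists_poly_det_pencil by blast
  obtain r where poly_r: "\<And>t. poly r t = det (mat 1 - P - mat t ** P)"
    using exists_poly_det_pencil by blast
  have P_idem: "P *v (P *v v) = P *v v" for v
    by (simp add: matrix_vector_mul_assoc idem)
  have reversal: "c * poly r t = poly q t" if "t \<noteq> 0" for t
  proof -
    have "(M ** P + (mat 1 - P) - mat (1 / t) ** P) ** (mat 1 - P - mat t ** P)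
        = mat 1 - mat t ** (M ** P)"
      unfolding matrix_eq using that
      by (simp add: P_idem mat_vector_mult vector_scalar_commute algebra_simps
          flip: matrix_vector_mul_assoc)
    then have "poly p (1 / t) * poly r t = poly q t"
      unfolding poly_p poly_q poly_r by (metis det_mul)
    then show ?thesis by (simp add: p_const)
  qed
  have "poly ([:0, 1:] * (smult c r - q)) t = 0" for t
    using reversal[of t] by (cases "t = 0") auto
  then have "smult c r = q"
    by (metis poly_all_0_iff_0 mult_eq_0_iff pCons_eq_0_iff one_neq_zero right_minus_eq)
  then have "c * poly r 0 = poly q 0" by (metis poly_smult)
  moreover have "poly r 0 = 0"
  proof -
    obtain v where "P *v v \<noteq> 0"
      using \<open>P \<noteq> 0\<close> by (metis matrix_eq matrix_vector_mult_0)
    moreover have "(mat 1 - P) *v (P *v v) = 0" by (simp add: algebra_simps P_idem)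
    ultimately show ?thesis unfolding poly_r det_eq_0_iff_kernel by auto
  qed
  ultimately show False by (simp add: poly_q)
qed

lemma exists_eigenvector_in_invariant_subspace:
  fixes M :: "complex^'n^'n"
  assumes subspace: "vec.subspace S" and nonzero_x: "x \<in> S" "x \<noteq> 0"
    and invariant: "\<And>y. y \<in> S \<Longrightarrow> M *v y \<in> S"
  obtains v z where "v \<in> S" "v \<noteq> 0" "M *v v = z *s v"
proof -
  obtain g where projection: "range g \<subseteq> S" "Vector_Spaces.linear (*s) (*s) g"
    "\<And>y. y \<in> S \<Longrightarrow> g y = y"
    using vec.linear_exists_left_inverse_on[OF vec.linear_id subspace] by auto
  define P where "P = matrix g"
  have P_projection: "P *v y \<in> S" "y \<in> S \<Longrightarrow> P *v y = y" for y
    using projection by (auto simp: P_def matrix_works)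
  have "P ** P = P"
    by (simp add: matrix_eq P_projection flip: matrix_vector_mul_assoc)
  moreover have "P \<noteq> 0" using P_projection(2)[OF nonzero_x(1)] nonzero_x(2) by auto
  ultimately obtain z where "det (M ** P + (mat 1 - P) - mat z ** P) = 0"
    by (rule exists_root_det_compression)
  then obtain v where "v \<noteq> 0" and kernel_v: "(M ** P + (mat 1 - P) - mat z ** P) *v v = 0"
    unfolding det_eq_0_iff_kernel by blast
  have kernel_split: "v - P *v v = z *s (P *v v) - M *v (P *v v)"
    using kernel_v by (simp add: algebra_simps mat_vector_mult flip: matrix_vector_mul_assoc)
  have "v - P *v v \<in> S"
    unfolding kernel_split
    by (intro vec.subspace_diff vec.subspace_scale subspace P_projection invariant)
  then have "v \<in> S"
    using vec.subspace_add[OF subspace _ P_projection(1)[of v]] by fastforce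
  moreover have "M *v v = z *s v"
    using kernel_split by (simp add: P_projection(2) \<open>v \<in> S\<close>)
  ultimately show ?thesis using that \<open>v \<noteq> 0\<close> by blast
qed

section \<open>The spectral theorem for normal matrices\<close>

definition normal_matrix :: "complex^'n^'n \<Rightarrow> bool" where
  "normal_matrix M \<longleftrightarrow> M ** conj_transpose M = conj_transpose M ** M"

lemma unitary_matrix_imp_normal: "unitary_matrix U \<Longrightarrow> normal_matrix U"
  by (simp add: unitary_matrix_def normal_matrix_def)

lemma normal_matrix_gram: "normal_matrix (conj_transpose X ** X)"
  by (simp add: normal_matrix_def conj_transpose_mult)

definition cinner :: "complex^'n \<Rightarrow> complex^'n \<Rightarrow> complex" where
  "cinner x y = (\<Sum>i\<in>UNIV. cnj (x $ i) * y $ i)"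

lemma cinner_self: "cinner x x = complex_of_real ((norm x)\<^sup>2)"
  by (simp add: cinner_def norm_vec_def L2_set_def sum_nonneg complex_norm_square mult.commute
      del: of_real_power)

lemma cinner_commute: "cinner x y = cnj (cinner y x)"
  by (simp add: cinner_def mult.commute)

lemma cinner_zero_right [simp]: "cinner x 0 = 0"
  by (simp add: cinner_def)

lemma cinner_add_right: "cinner x (y + z) = cinner x y + cinner x z"
  by (simp add: cinner_def algebra_simps sum.distrib)

lemma cinner_diff_right: "cinner x (y - z) = cinner x y - cinner x z"
  by (simp add: cinner_def algebra_simps sum_subtractf)

lemma cinner_diff_left: "cinner (x - y) z = cinner x z - cinner y z"
  by (simp add: cinner_def algebra_simps sum_subtractf)

lemma cinner_scale_right: "cinner x (c *s y) = c * cinner x y"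
  by (simp add: cinner_def sum_distrib_left mult.left_commute)

lemma cinner_scale_left: "cinner (c *s x) y = cnj c * cinner x y"
  by (simp add: cinner_def sum_distrib_left mult.assoc)

lemma cinner_matrix_vector_right: "cinner x (M *v y) = cinner (conj_transpose M *v x) y"
proof -
  have "cinner x (M *v y) = (\<Sum>i\<in>UNIV. \<Sum>j\<in>UNIV. cnj (x $ i) * (M $ i $ j * y $ j))"
    by (simp add: cinner_def matrix_vector_mult_def sum_distrib_left)
  also have "\<dots> = (\<Sum>j\<in>UNIV. \<Sum>i\<in>UNIV. cnj (x $ i) * (M $ i $ j * y $ j))"
    by (rule sum.swap)
  also have "\<dots> = cinner (conj_transpose M *v x) y"
    by (simp add: cinner_def matrix_vector_mult_def sum_distrib_left sum_distrib_right algebra_simps)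
  finally show ?thesis .
qed

lemma conj_transpose_mult_nth: "(conj_transpose A ** B) $ i $ j = cinner (column i A) (column j B)"
  by (simp add: cinner_def matrix_matrix_mult_def column_def)

lemma norm_column_unitary_matrix: "unitary_matrix U \<Longrightarrow> norm (column k U) = 1"
  using conj_transpose_mult_nth[of U U k k]
  by (simp add: unitary_matrixD mat_def cinner_self abs_square_eq_1 del: of_real_power)

lemma exists_orthogonal_vector:
  fixes w :: "'n \<Rightarrow> complex^'n"
  assumes "k \<notin> J"
  obtains x where "x \<noteq> 0" "\<And>i. i \<in> J \<Longrightarrow> cinner (w i) x = 0"
proof -
  define A :: "complex^'n^'n" where "A = (\<chi> i. if i \<in> J then (\<chi> j. cnj (w i $ j)) else 0)"
  have "row k A = 0" using assms by (simp add: row_def A_def vec_eq_iff)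
  then have "det A = 0" by (rule det_zero_row)
  then obtain x where "x \<noteq> 0" "A *v x = 0" unfolding det_eq_0_iff_kernel by blast
  moreover have "cinner (w i) x = (A *v x) $ i" if "i \<in> J" for i
    using that by (simp add: A_def matrix_vector_mult_def cinner_def)
  ultimately show ?thesis using that by simp
qed

lemma eigenvector_conj_transpose_normal:
  assumes "normal_matrix M" and eig: "M *v v = \<mu> *s v"
  shows "conj_transpose M *v v = cnj \<mu> *s v"
proof -
  define w where "w = conj_transpose M *v v"
  have inner: "cinner v w = cnj \<mu> * cinner v v" "cinner w v = \<mu> * cinner v v"
    using cinner_matrix_vector_right[of v M v] cinner_matrix_vector_right[of v "conj_transpose M" v]
    by (simp_all add: w_def eig cinner_scale_left cinner_scale_right)
  have "cinner w w = cinner v (conj_transpose M *v (M *v v))"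
    using assms(1) by (simp add: w_def normal_matrix_def matrix_vector_mul_assoc
        flip: cinner_matrix_vector_right)
  also have "\<dots> = \<mu> * cnj \<mu> * cinner v v"
    by (simp add: eig inner vector_scalar_commute cinner_scale_right flip: w_def)
  finally have "cinner (w - cnj \<mu> *s v) (w - cnj \<mu> *s v) = 0"
    by (simp add: cinner_diff_left cinner_diff_right cinner_scale_left cinner_scale_right inner)
  then show ?thesis by (simp add: cinner_self w_def)
qed

lemma exists_orthogonal_unit_eigenvector:
  fixes M :: "complex^'n^'n" and w :: "'n \<Rightarrow> complex^'n"
  assumes normal: "normal_matrix M" and eig: "\<And>i. i \<in> J \<Longrightarrow> M *v w i = d i *s w i"
    and "k \<notin> J"
  obtains e \<mu> where "M *v e = \<mu> *s e" "cinner e e = 1" "\<And>i. i \<in> J \<Longrightarrow> cinner (w i) e = 0"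
proof -
  define S where "S = {x. \<forall>i\<in>J. cinner (w i) x = 0}"
  obtain x where "x \<noteq> 0" "\<And>i. i \<in> J \<Longrightarrow> cinner (w i) x = 0"
    using exists_orthogonal_vector[OF \<open>k \<notin> J\<close>] by blast
  then have "x \<in> S" "x \<noteq> 0" by (simp_all add: S_def)
  moreover have "vec.subspace S"
    by (simp add: S_def vec.subspace_def cinner_add_right cinner_scale_right)
  moreover have "M *v y \<in> S" if "y \<in> S" for y
    using that by (simp add: S_def cinner_matrix_vector_right cinner_scale_left
        eigenvector_conj_transpose_normal[OF normal eig])
  ultimately obtain v \<mu> where eigenvector_v: "v \<in> S" "v \<noteq> 0" "M *v v = \<mu> *s v"
    using exists_eigenvector_in_invariant_subspace by metis
  define e where "e = complex_of_real (1 / norm v) *s v"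
  have "M *v e = \<mu> *s e"
    by (simp add: e_def eigenvector_v(3) vector_scalar_commute vec.scale_left_commute)
  moreover have "cinner e e = 1"
    using eigenvector_v(2)
    by (simp add: e_def cinner_scale_left cinner_scale_right cinner_self[of v] power2_eq_square)
  moreover have "cinner (w i) e = 0" if "i \<in> J" for i
    using that eigenvector_v(1) by (simp add: e_def cinner_scale_right S_def)
  ultimately show ?thesis by (rule that)
qed

lemma exists_orthonormal_eigenvectors:
  fixes M :: "complex^'n^'n" and J :: "'n set"
  assumes normal: "normal_matrix M"
  shows "\<exists>(w :: 'n \<Rightarrow> complex^'n) d. (\<forall>i\<in>J. M *v w i = d i *s w i) \<and>
    (\<forall>i\<in>J. \<forall>j\<in>J. cinner (w i) (w j) = of_bool (i = j))"
  using finite[of J]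
proof (induction J rule: finite_induct)
  case (insert k J)
  then obtain w :: "'n \<Rightarrow> complex^'n" and d where
    eig: "\<And>i. i \<in> J \<Longrightarrow> M *v w i = d i *s w i" and
    orthonormal: "\<And>i j. i \<in> J \<Longrightarrow> j \<in> J \<Longrightarrow> cinner (w i) (w j) = of_bool (i = j)"
    by blast
  obtain e \<mu> where "M *v e = \<mu> *s e" "cinner e e = 1"
    and perp: "\<And>i. i \<in> J \<Longrightarrow> cinner (w i) e = 0"
    using exists_orthogonal_unit_eigenvector[of M J w d k, OF normal eig \<open>k \<notin> J\<close>] by blast
  moreover have "cinner e (w i) = 0" if "i \<in> J" for i
    using perp[OF that] by (subst cinner_commute) simp
  ultimately have "(\<forall>i\<in>insert k J. M *v (w(k := e)) i = (d(k := \<mu>)) i *s (w(k := e)) i) \<and>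
      (\<forall>i\<in>insert k J. \<forall>j\<in>insert k J. cinner ((w(k := e)) i) ((w(k := e)) j) = of_bool (i = j))"
    using \<open>k \<notin> J\<close> eig orthonormal by auto
  then show ?case by blast
qed simp

lemma normal_matrix_unitarily_diagonalizable:
  fixes M :: "complex^'n^'n"
  assumes "normal_matrix M"
  obtains V d where "unitary_matrix V" "M = conjugate_by V (cdiag d)"
proof -
  obtain w :: "'n \<Rightarrow> complex^'n" and d where eig: "\<And>i. M *v w i = d i *s w i"
    and orthonormal: "\<And>i j. cinner (w i) (w j) = of_bool (i = j)"
    using exists_orthonormal_eigenvectors[OF assms, of UNIV] by auto
  define V where "V = (\<chi> i j. w j $ i)"
  have column_V: "column j V = w j" for j by (simp add: column_def V_def vec_eq_iff)
  have unitary_V: "unitary_matrix V"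
    by (rule unitary_matrixI)
      (simp add: vec_eq_iff conj_transpose_mult_nth column_V orthonormal mat_def of_bool_def)
  have "(M ** V) $ i $ j = (M *v w j) $ i" for i j
    by (simp add: matrix_matrix_mult_def matrix_vector_mult_def V_def)
  then have "M ** V = V ** cdiag d"
    by (simp add: vec_eq_iff eig) (simp add: V_def mult.commute)
  then have "M = conjugate_by V (cdiag d)"
    by (metis conjugate_by_def unitary_V unitary_matrixD(2) matrix_mul_assoc matrix_mul_rid)
  then show ?thesis using that unitary_V by blast
qed

section \<open>Polar decomposition\<close>

lemma of_real_norm_column_mult_power2:
  assumes "unitary_matrix V" and "conj_transpose X ** X = conjugate_by V (cdiag d)"
  shows "complex_of_real ((norm (column k (X ** V)))\<^sup>2) = d k"
proof -
  have "conj_transpose (X ** V) ** (X ** V) = conj_transpose V ** ((conj_transpose X ** X) ** V)"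
    by (simp add: conj_transpose_mult matrix_mul_assoc)
  also have "\<dots> = cdiag d"
    by (simp add: assms conjugate_by_mult_right matrix_mul_assoc unitary_matrixD)
  finally have "(conj_transpose (X ** V) ** (X ** V)) $ k $ k = d k"
    by (simp add: cdiag_def)
  then show ?thesis by (simp only: conj_transpose_mult_nth cinner_self)
qed

locale gram_eigenbasis =
  fixes X V :: "complex^'n^'n" and s :: "'n \<Rightarrow> real"
  assumes unitary_V: "unitary_matrix V"
    and singular_value_pos: "s k > 0"
    and gram_eq: "conj_transpose X ** X = conjugate_by V (cdiag (\<lambda>k. complex_of_real ((s k)\<^sup>2)))"
begin

definition inverse_modulus :: "complex^'n^'n" where
  "inverse_modulus = conjugate_by V (cdiag (\<lambda>k. complex_of_real (1 / s k)))"

definition polar_factor :: "complex^'n^'n" where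
  "polar_factor = X ** inverse_modulus"

lemma unitary_polar_factor: "unitary_matrix polar_factor"
proof (rule unitary_matrixI)
  have "conj_transpose polar_factor ** polar_factor
      = inverse_modulus ** (conj_transpose X ** X) ** inverse_modulus"
    by (simp add: polar_factor_def inverse_modulus_def conj_transpose_mult
        conj_transpose_conjugate_by conj_transpose_cdiag matrix_mul_assoc)
  also have "\<dots> = conjugate_by V
      (cdiag (\<lambda>k. complex_of_real (1 / s k) * of_real ((s k)\<^sup>2) * of_real (1 / s k)))"
    by (simp add: inverse_modulus_def gram_eq cdiag_mult unitary_V flip: conjugate_by_mult)
  also have "cdiag (\<lambda>k. complex_of_real (1 / s k) * of_real ((s k)\<^sup>2) * of_real (1 / s k)) = mat 1"
    using singular_value_pos
    by (simp add: cdiag_eq_mat_1_iff power2_eq_square less_imp_neq[symmetric])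
  finally show "conj_transpose polar_factor ** polar_factor = mat 1"
    by (simp add: conjugate_by_mat_1 unitary_V)
qed

lemma norm_column_mult_eigenbasis: "norm (column k (X ** V)) = s k"
proof -
  have "(norm (column k (X ** V)))\<^sup>2 = (s k)\<^sup>2"
    using of_real_norm_column_mult_power2[OF unitary_V gram_eq] by (simp only: of_real_eq_iff)
  then show ?thesis
    using singular_value_pos[of k] by (simp add: power2_eq_iff_nonneg)
qed

text \<open>Compare column by column in the eigenbasis: there the polar factor rescales the columns of \<open>X\<close>
  to unit length, and the columns of any unitary matrix have unit length.\<close>

lemma norm_polar_factor_diff_le:
  assumes "unitary_matrix U"
  shows "norm (polar_factor - X) \<le> norm (X - U)"
proof -
  have factor: "polar_factor ** V = X ** V ** cdiag (\<lambda>k. complex_of_real (1 / s k))"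
    unfolding polar_factor_def inverse_modulus_def
    by (metis conjugate_by_mult_right matrix_mul_assoc unitary_V)
  have "norm (column k ((polar_factor - X) ** V)) \<le> norm (column k ((X - U) ** V))" for k
  proof -
    have "column k ((polar_factor - X) ** V) = (1 / s k - 1) *\<^sub>R column k (X ** V)"
      by (simp add: vec_eq_iff column_def matrix_diff_rdistrib factor algebra_simps
          scaleR_conv_of_real[where 'a = complex])
    then have "norm (column k ((polar_factor - X) ** V)) = \<bar>1 / s k - 1\<bar> * s k"
      by (simp add: norm_column_mult_eigenbasis)
    also have "\<dots> = \<bar>s k - 1\<bar>"
      using singular_value_pos[of k] by (simp add: abs_if field_simps)
    also have "\<dots> = \<bar>norm (column k (X ** V)) - norm (column k (U ** V))\<bar>"
      by (simp add: norm_column_mult_eigenbasis norm_column_unitary_matrix unitary_matrix_mult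
          assms unitary_V)
    also have "\<dots> \<le> norm (column k (X ** V) - column k (U ** V))"
      by (rule norm_triangle_ineq3)
    also have "column k (X ** V) - column k (U ** V) = column k ((X - U) ** V)"
      by (simp add: vec_eq_iff column_def matrix_diff_rdistrib)
    finally show ?thesis .
  qed
  then have "(norm ((polar_factor - X) ** V))\<^sup>2 \<le> (norm ((X - U) ** V))\<^sup>2"
    unfolding norm_matrix_power2_columns by (intro sum_mono power_mono) auto
  then show ?thesis by (simp add: norm_mult_unitary_right unitary_V)
qed

lemma commutes_polar_factor:
  assumes "C ** X = X ** C" "C ** conj_transpose X = conj_transpose X ** C"
  shows "C ** polar_factor = polar_factor ** C"
proof -
  have "C ** (conj_transpose X ** X) = (conj_transpose X ** X) ** C"
    by (metis assms matrix_mul_assoc)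
  then have "C ** inverse_modulus = inverse_modulus ** C"
    unfolding gram_eq inverse_modulus_def
    by (rule commutes_conjugate_by_cdiag_cong[OF unitary_V])
      (use singular_value_pos in \<open>simp add: power2_eq_iff_nonneg less_imp_le del: of_real_power\<close>)
  then show ?thesis unfolding polar_factor_def by (metis assms(1) matrix_mul_assoc)
qed

end

lemma exists_gram_eigenbasis:
  assumes "det X \<noteq> 0"
  shows "\<exists>V s. gram_eigenbasis X V s"
proof -
  obtain V d where unitary_V: "unitary_matrix V"
    and gram: "conj_transpose X ** X = conjugate_by V (cdiag d)"
    using normal_matrix_gram by (rule normal_matrix_unitarily_diagonalizable)
  define s where "s k = norm (column k (X ** V))" for k
  have "d = (\<lambda>k. of_real ((s k)\<^sup>2))"
    using of_real_norm_column_mult_power2[OF unitary_V gram]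
    by (simp add: s_def fun_eq_iff del: of_real_power)
  moreover have "s k > 0" for k
    using assms det_unitary_nonzero[OF unitary_V] det_zero_column[of k "X ** V"]
    by (auto simp: s_def det_mul)
  ultimately have "gram_eigenbasis X V s"
    using unitary_V gram by (simp only: gram_eigenbasis_def simp_thms)
  then show ?thesis by blast
qed

lemma eventually_det_segment_to_identity_nonzero:
  fixes X :: "complex^'n^'n"
  shows "\<forall>\<^sub>F t in at a. det (X - mat t ** (X - mat 1)) \<noteq> 0"
proof -
  obtain p where poly_p: "\<And>t. poly p t = det (X - mat t ** (X - mat 1))"
    using exists_poly_det_pencil by blast
  have "poly p 1 = 1" by (simp add: poly_p)
  then have "p \<noteq> 0" by force
  then have "finite {t. poly p t = 0}" by (rule poly_roots_finite)
  then show ?thesis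
    using islimpt_finite[of "{t. poly p t = 0}" a] by (simp add: islimpt_iff_eventually poly_p)
qed

text \<open>Moving \<open>X\<close> slightly towards the identity makes it invertible without leaving the commutant of
  \<open>C\<close>.\<close>

lemma exists_invertible_in_commutant_near:
  fixes X C :: "complex^'n^'n"
  assumes comm: "C ** X = X ** C" "C ** conj_transpose X = conj_transpose X ** C"
    and near: "norm (X - U) < r"
  obtains Y where "det Y \<noteq> 0" "C ** Y = Y ** C" "C ** conj_transpose Y = conj_transpose Y ** C"
    "norm (Y - U) < r"
proof -
  define Y where "Y t = X - mat t ** (X - mat 1)" for t
  have "(Y \<longlongrightarrow> Y 0) (at 0)"
    unfolding Y_def by (intro vec_tendstoI) (auto intro!: tendsto_eq_intros)
  then have "((\<lambda>t. norm (Y t - U)) \<longlongrightarrow> norm (Y 0 - U)) (at 0)"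
    by (intro tendsto_norm tendsto_diff tendsto_const)
  then have "\<forall>\<^sub>F t in at 0. norm (Y t - U) < r"
    by (rule order_tendstoD) (simp add: Y_def near)
  moreover have "\<forall>\<^sub>F t in at 0. det (Y t) \<noteq> 0"
    unfolding Y_def by (rule eventually_det_segment_to_identity_nonzero)
  ultimately have "\<forall>\<^sub>F t in at 0. norm (Y t - U) < r \<and> det (Y t) \<noteq> 0"
    by (rule eventually_conj)
  then obtain t where Y_t: "norm (Y t - U) < r" "det (Y t) \<noteq> 0"
    using eventually_happens[of _ "at (0 :: complex)"] by auto
  have "C ** mat z = mat z ** C" for z
    by (simp add: vec_eq_iff mult.commute)
  then have commutes: "C ** (Z - mat z ** (Z - mat 1)) = (Z - mat z ** (Z - mat 1)) ** C"
    if "C ** Z = Z ** C" for z Z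
    using that
    by (simp add: matrix_diff_ldistrib matrix_diff_rdistrib) (metis matrix_mul_assoc)
  have "conj_transpose (Y t) = conj_transpose X - mat (cnj t) ** (conj_transpose X - mat 1)"
    by (simp add: vec_eq_iff Y_def) (simp add: mat_def)
  then have "C ** Y t = Y t ** C" "C ** conj_transpose (Y t) = conj_transpose (Y t) ** C"
    unfolding Y_def by (simp_all only: commutes comm)
  with Y_t show ?thesis by (intro that)
qed

lemma exists_unitary_in_commutant_near:
  fixes X C :: "complex^'n^'n"
  assumes comm: "C ** X = X ** C" "C ** conj_transpose X = conj_transpose X ** C"
    and unitary_U: "unitary_matrix U" and near: "norm (X - U) < r"
  obtains A where "unitary_matrix A" "C ** A = A ** C" "norm (U - A) < 2 * r"
proof -
  obtain Y where "det Y \<noteq> 0" and commutes: "C ** Y = Y ** C"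
    "C ** conj_transpose Y = conj_transpose Y ** C" and Y_near: "norm (Y - U) < r"
    using exists_invertible_in_commutant_near[OF comm near] by blast
  then obtain V s where "gram_eigenbasis Y V s"
    using exists_gram_eigenbasis by blast
  then interpret gram_eigenbasis Y V s .
  have "norm (U - polar_factor) \<le> norm (Y - U) + norm (polar_factor - Y)"
    using norm_triangle_ineq[of "Y - U" "polar_factor - Y"] by (simp add: norm_minus_commute)
  also have "\<dots> < 2 * r"
    using norm_polar_factor_diff_le[OF unitary_U] Y_near by simp
  finally show ?thesis
    by (rule that[OF unitary_polar_factor commutes_polar_factor[OF commutes]])
qed

section \<open>Pinching along a shifted grid\<close>

definition pinching :: "('n \<Rightarrow> 'c) \<Rightarrow> complex^'n^'n \<Rightarrow> complex^'n^'n" where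
  "pinching c A = (\<chi> i j. if c i = c j then A $ i $ j else 0)"

lemma conj_transpose_pinching: "conj_transpose (pinching c A) = pinching c (conj_transpose A)"
  by (auto simp: vec_eq_iff pinching_def)

lemma cdiag_commutes_pinching:
  assumes "\<And>i j. c i = c j \<Longrightarrow> a i = a j"
  shows "cdiag a ** pinching c A = pinching c A ** cdiag a"
  by (simp add: vec_eq_iff pinching_def) (metis assms mult.commute)

lemma norm_pinching_diff_power2:
  "(norm (pinching c A - A))\<^sup>2 = (\<Sum>i\<in>UNIV. \<Sum>j\<in>UNIV. of_bool (c i \<noteq> c j) * (cmod (A $ i $ j))\<^sup>2)"
  unfolding norm_matrix_power2 by (intro sum.cong refl) (simp add: pinching_def)

lemma has_integral_floor_add: "((\<lambda>t. real_of_int \<lfloor>x + t\<rfloor>) has_integral x) {0..1}"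
proof -
  define b where "b = 1 - frac x"
  have b_bounds: "0 \<le> b" "b \<le> 1" "x + b = \<lfloor>x\<rfloor> + 1"
    using frac_lt_1[of x] by (auto simp: b_def frac_def)
  have "((\<lambda>t. real_of_int \<lfloor>x\<rfloor>) has_integral \<lfloor>x\<rfloor> * b) {0..b}"
    using has_integral_const_real[of "real_of_int \<lfloor>x\<rfloor>" 0 b] b_bounds(1)
    by (simp add: mult.commute)
  then have left: "((\<lambda>t. real_of_int \<lfloor>x + t\<rfloor>) has_integral \<lfloor>x\<rfloor> * b) {0..b}"
  proof (rule has_integral_spike_finite[of "{b}", rotated 2])
    fix t assume "t \<in> {0..b} - {b}"
    then have "\<lfloor>x + t\<rfloor> = \<lfloor>x\<rfloor>" using b_bounds(3) unfolding floor_eq_iff by simp linarith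
    then show "real_of_int \<lfloor>x + t\<rfloor> = real_of_int \<lfloor>x\<rfloor>" by simp
  qed simp
  have "((\<lambda>t. real_of_int (\<lfloor>x\<rfloor> + 1)) has_integral (\<lfloor>x\<rfloor> + 1) * (1 - b)) {b..1}"
    using has_integral_const_real[of "real_of_int (\<lfloor>x\<rfloor> + 1)" b 1] b_bounds(2)
    by (simp add: mult.commute)
  then have right: "((\<lambda>t. real_of_int \<lfloor>x + t\<rfloor>) has_integral (\<lfloor>x\<rfloor> + 1) * (1 - b)) {b..1}"
  proof (rule has_integral_eq[rotated])
    fix t assume "t \<in> {b..1}"
    then have "\<lfloor>x + t\<rfloor> = \<lfloor>x\<rfloor> + 1" using b_bounds(1,3) unfolding floor_eq_iff by simp linarith
    then show "real_of_int (\<lfloor>x\<rfloor> + 1) = real_of_int \<lfloor>x + t\<rfloor>" by simp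
  qed
  have "\<lfloor>x\<rfloor> * b + (\<lfloor>x\<rfloor> + 1) * (1 - b) = x"
    by (simp add: b_def frac_def algebra_simps)
  then show ?thesis
    using has_integral_combine[OF b_bounds(1,2) left right] by simp
qed

lemma has_integral_abs_floor_diff:
  "((\<lambda>t. \<bar>real_of_int \<lfloor>x + t\<rfloor> - \<lfloor>y + t\<rfloor>\<bar>) has_integral \<bar>x - y\<bar>) {0..1}"
proof (induction x y rule: linorder_wlog)
  case (le x y)
  have "((\<lambda>t. real_of_int \<lfloor>y + t\<rfloor> - \<lfloor>x + t\<rfloor>) has_integral y - x) {0..1}"
    by (intro has_integral_diff has_integral_floor_add)
  moreover have "\<bar>real_of_int \<lfloor>x + t\<rfloor> - \<lfloor>y + t\<rfloor>\<bar> = real_of_int \<lfloor>y + t\<rfloor> - \<lfloor>x + t\<rfloor>" for t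
    using le floor_mono[of "x + t" "y + t"] by simp
  ultimately show ?case using le by simp
next
  case (sym x y)
  then show ?case by (simp add: abs_minus_commute)
qed

lemma has_integral_less_imp_exists_less:
  fixes f :: "real \<Rightarrow> real"
  assumes "(f has_integral I) {a..b}" "a \<le> b" "I < r * (b - a)"
  shows "\<exists>t\<in>{a..b}. f t < r"
proof (rule ccontr)
  assume "\<not> (\<exists>t\<in>{a..b}. f t < r)"
  then have "r * (b - a) \<le> I"
    using has_integral_le[OF has_integral_const_real assms(1), of r] assms(2)
    by (simp add: not_less mult.commute)
  then show False using assms(3) by simp
qed

definition grid_cell :: "real \<Rightarrow> real \<Rightarrow> complex \<Rightarrow> int \<times> int" where
  "grid_cell L t z = (\<lfloor>Re z / L + t\<rfloor>, \<lfloor>Im z / L + t\<rfloor>)"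

definition grid_lines_between :: "real \<Rightarrow> real \<Rightarrow> complex \<Rightarrow> complex \<Rightarrow> real" where
  "grid_lines_between L t z w = \<bar>real_of_int \<lfloor>Re z / L + t\<rfloor> - \<lfloor>Re w / L + t\<rfloor>\<bar>
    + \<bar>real_of_int \<lfloor>Im z / L + t\<rfloor> - \<lfloor>Im w / L + t\<rfloor>\<bar>"

lemma cmod_diff_le_same_grid_cell:
  assumes "L > 0" and "grid_cell L t z = grid_cell L t w"
  shows "cmod (z - w) \<le> 2 * L"
proof -
  have "\<bar>Re z / L - Re w / L\<bar> \<le> 1" "\<bar>Im z / L - Im w / L\<bar> \<le> 1"
    using assms(2) unfolding grid_cell_def prod.inject by linarith+
  then have "\<bar>Re (z - w)\<bar> \<le> L" "\<bar>Im (z - w)\<bar> \<le> L"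
    using assms(1) by (simp_all add: field_simps flip: diff_divide_distrib)
  then show ?thesis using cmod_le[of "z - w"] by linarith
qed

lemma grid_cell_neq_le_grid_lines_between:
  "of_bool (grid_cell L t z \<noteq> grid_cell L t w) \<le> grid_lines_between L t z w"
  by (auto simp: grid_cell_def grid_lines_between_def)

lemma has_integral_grid_lines_between:
  assumes "L > 0"
  shows "((\<lambda>t. grid_lines_between L t z w)
    has_integral (\<bar>Re (z - w)\<bar> + \<bar>Im (z - w)\<bar>) / L) {0..1}"
proof -
  have "(\<bar>Re (z - w)\<bar> + \<bar>Im (z - w)\<bar>) / L
      = \<bar>Re z / L - Re w / L\<bar> + \<bar>Im z / L - Im w / L\<bar>"
    using assms by (simp add: add_divide_distrib flip: diff_divide_distrib)
  then show ?thesis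
    unfolding grid_lines_between_def by (simp only: has_integral_add has_integral_abs_floor_diff)
qed

text \<open>Over a uniformly random shift, the expected number of grid lines between two points is at most
  proportional to their distance, and some shift does no worse than the average.\<close>

lemma exists_grid_shift:
  fixes z :: "'i::finite \<Rightarrow> complex" and w :: "'i \<Rightarrow> 'i \<Rightarrow> real"
  assumes L_pos: "L > 0" and w_nonneg: "\<And>i j. w i j \<ge> 0"
    and bound: "(\<Sum>i\<in>UNIV. \<Sum>j\<in>UNIV. w i j * (2 * cmod (z i - z j) / L)) < r"
  obtains t where
    "(\<Sum>i\<in>UNIV. \<Sum>j\<in>UNIV. of_bool (grid_cell L t (z i) \<noteq> grid_cell L t (z j)) * w i j) < r"
proof -
  let ?mean = "\<lambda>i j. (\<bar>Re (z i - z j)\<bar> + \<bar>Im (z i - z j)\<bar>) / L"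
  have "\<bar>Re (z i - z j)\<bar> + \<bar>Im (z i - z j)\<bar> \<le> 2 * cmod (z i - z j)" for i j
    using abs_Re_le_cmod[of "z i - z j"] abs_Im_le_cmod[of "z i - z j"] by linarith
  then have mean_less: "(\<Sum>i\<in>UNIV. \<Sum>j\<in>UNIV. w i j * ?mean i j) < r"
    using L_pos
    by (intro le_less_trans[OF _ bound] sum_mono mult_left_mono divide_right_mono w_nonneg) auto
  have "((\<lambda>t. \<Sum>i\<in>UNIV. \<Sum>j\<in>UNIV. w i j * grid_lines_between L t (z i) (z j))
      has_integral (\<Sum>i\<in>UNIV. \<Sum>j\<in>UNIV. w i j * ?mean i j)) {0..1}"
    by (intro has_integral_sum finite has_integral_mult_right
        has_integral_grid_lines_between L_pos)
  then obtain t where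
    "(\<Sum>i\<in>UNIV. \<Sum>j\<in>UNIV. w i j * grid_lines_between L t (z i) (z j)) < r"
    using has_integral_less_imp_exists_less[of _ _ 0 1 r] mean_less by auto
  moreover have "of_bool (grid_cell L t (z i) \<noteq> grid_cell L t (z j)) * w i j
      \<le> w i j * grid_lines_between L t (z i) (z j)" for i j
    using mult_left_mono[OF grid_cell_neq_le_grid_lines_between w_nonneg] by (simp add: mult.commute)
  ultimately show ?thesis
    by (intro that[of t]) (elim le_less_trans[rotated], intro sum_mono)
qed

section \<open>Almost commuting unitaries\<close>

lemma commutator_eq_0_iff: "commutator A B = 0 \<longleftrightarrow> A ** B = B ** A"
  by (simp add: commutator_def)

lemma sum_cmod_power2_mult_dist_le:
  fixes B :: "complex^'n^'n"
  shows "(\<Sum>i\<in>UNIV. \<Sum>j\<in>UNIV. (cmod (B $ i $ j))\<^sup>2 * cmod (\<mu> i - \<mu> j))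
    \<le> norm B * norm (commutator (cdiag \<mu>) B)"
proof -
  have "commutator (cdiag \<mu>) B $ i $ j = B $ i $ j * (\<mu> i - \<mu> j)" for i j
    by (simp add: commutator_def algebra_simps)
  then have "(\<Sum>i\<in>UNIV. \<Sum>j\<in>UNIV. (cmod (B $ i $ j))\<^sup>2 * cmod (\<mu> i - \<mu> j))
      = (\<Sum>i\<in>UNIV. \<Sum>j\<in>UNIV. \<bar>cmod (B $ i $ j)\<bar> * \<bar>cmod (commutator (cdiag \<mu>) B $ i $ j)\<bar>)"
    by (simp add: norm_mult power2_eq_square mult.assoc)
  also have "\<dots> \<le> norm B * norm (commutator (cdiag \<mu>) B)"
    using L2_set_mult_ineq[of "\<lambda>(i, j). cmod (B $ i $ j)"
        "\<lambda>(i, j). cmod (commutator (cdiag \<mu>) B $ i $ j)" UNIV]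
    by (simp add: norm_matrix_eq_L2_set sum.cartesian_product case_prod_unfold flip: UNIV_Times_UNIV)
  finally show ?thesis .
qed

lemma exists_pinching_near:
  fixes B :: "complex^'n^'n"
  assumes L_pos: "L > 0" and "r > 0"
    and small: "2 * (norm B * norm (commutator (cdiag \<mu>) B)) < L * r\<^sup>2"
  obtains c :: "'n \<Rightarrow> int \<times> int" where
    "\<And>i j. c i = c j \<Longrightarrow> cmod (\<mu> i - \<mu> j) \<le> 2 * L" "norm (pinching c B - B) < r"
proof -
  let ?w = "\<lambda>i j. (cmod (B $ i $ j))\<^sup>2"
  have "(\<Sum>i\<in>UNIV. \<Sum>j\<in>UNIV. ?w i j * (2 * cmod (\<mu> i - \<mu> j) / L))
      = 2 * (\<Sum>i\<in>UNIV. \<Sum>j\<in>UNIV. ?w i j * cmod (\<mu> i - \<mu> j)) / L"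
    by (simp add: sum_distrib_left sum_divide_distrib mult_ac)
  also have "\<dots> \<le> 2 * (norm B * norm (commutator (cdiag \<mu>) B)) / L"
    using L_pos by (intro divide_right_mono mult_left_mono sum_cmod_power2_mult_dist_le) simp_all
  also have "\<dots> < r\<^sup>2"
    using small L_pos by (simp add: pos_divide_less_eq mult.commute)
  finally obtain t where
    "(\<Sum>i\<in>UNIV. \<Sum>j\<in>UNIV. of_bool (grid_cell L t (\<mu> i) \<noteq> grid_cell L t (\<mu> j)) * ?w i j) < r\<^sup>2"
    using exists_grid_shift[OF L_pos, of ?w] zero_le_power2 by blast
  then have "(norm (pinching (\<lambda>i. grid_cell L t (\<mu> i)) B - B))\<^sup>2 < r\<^sup>2"
    by (simp only: norm_pinching_diff_power2)
  then have "norm (pinching (\<lambda>i. grid_cell L t (\<mu> i)) B - B) < r"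
    using \<open>r > 0\<close> by (simp add: power2_less_imp_less)
  then show ?thesis
    by (intro that[of "\<lambda>i. grid_cell L t (\<mu> i)"] cmod_diff_le_same_grid_cell[OF L_pos, of t])
qed

lemma exists_commuting_unitary_near_cdiag:
  fixes U :: "complex^'n^'n"
  assumes unitary_U: "unitary_matrix U" and L_pos: "L > 0" and noncomm: "commutator (cdiag \<mu>) U \<noteq> 0"
  obtains a A where "range a \<subseteq> range \<mu>" "unitary_matrix A" "commutator (cdiag a) A = 0"
    "norm_tr (cdiag \<mu> - cdiag a) \<le> 2 * L"
    "norm_tr (U - A) \<le> 4 * sqrt (norm_tr (commutator (cdiag \<mu>) U) / L)"
proof -
  define \<epsilon> where "\<epsilon> = norm_tr (commutator (cdiag \<mu>) U)"
  define r where "r = 2 * sqrt (\<epsilon> / L) * sqrt CARD('n)"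
  have "\<epsilon> > 0" using noncomm by (simp add: \<epsilon>_def norm_tr_eq)
  have "norm U * norm (commutator (cdiag \<mu>) U) = \<epsilon> * CARD('n)"
    using norm_eq_norm_tr[of "commutator (cdiag \<mu>) U"]
    by (simp add: norm_unitary_matrix unitary_U flip: \<epsilon>_def)
  then have "2 * (norm U * norm (commutator (cdiag \<mu>) U)) < L * r\<^sup>2"
    using L_pos \<open>\<epsilon> > 0\<close> by (simp add: r_def power_mult_distrib)
  moreover have "r > 0"
    using L_pos \<open>\<epsilon> > 0\<close> by (simp add: r_def)
  ultimately obtain c :: "'n \<Rightarrow> int \<times> int" where
    near: "\<And>i j. c i = c j \<Longrightarrow> cmod (\<mu> i - \<mu> j) \<le> 2 * L" and
    pinch: "norm (pinching c U - U) < r"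
    using exists_pinching_near[OF L_pos] by metis
  define a where "a i = \<mu> (inv c (c i))" for i
  have "cdiag a ** pinching c B = pinching c B ** cdiag a" for B
    by (rule cdiag_commutes_pinching) (simp add: a_def)
  then obtain A where A_props: "unitary_matrix A" "cdiag a ** A = A ** cdiag a" "norm (U - A) < 2 * r"
    using exists_unitary_in_commutant_near[OF _ _ unitary_U pinch, of "cdiag a"]
    by (metis conj_transpose_pinching)
  have "cmod (\<mu> i - a i) \<le> 2 * L" for i
    unfolding a_def by (rule near) (simp add: f_inv_into_f)
  then have "norm_tr (cdiag \<mu> - cdiag a) \<le> 2 * L"
    unfolding norm_tr_le_iff cdiag_diff by (rule norm_cdiag_le)
  moreover have "norm_tr (U - A) \<le> 4 * sqrt (\<epsilon> / L)"
    using A_props(3) by (simp add: norm_tr_le_iff r_def)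
  moreover have "range a \<subseteq> range \<mu>" by (auto simp: a_def)
  ultimately show ?thesis
    using that A_props(1,2) unfolding \<epsilon>_def commutator_eq_0_iff by blast
qed

lemma exists_commuting_unitaries_near:
  fixes U\<^sub>1 U\<^sub>2 :: "complex^'n^'n"
  assumes unitary_U: "unitary_matrix U\<^sub>1" "unitary_matrix U\<^sub>2"
    and L_pos: "L > 0" and noncomm: "commutator U\<^sub>1 U\<^sub>2 \<noteq> 0"
  shows "\<exists>A\<^sub>1 A\<^sub>2. unitary_matrix A\<^sub>1 \<and> unitary_matrix A\<^sub>2 \<and> commutator A\<^sub>1 A\<^sub>2 = 0 \<and>
    commutator A\<^sub>1 U\<^sub>1 = 0 \<and> norm_tr (U\<^sub>1 - A\<^sub>1) \<le> 2 * L \<and>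
    norm_tr (U\<^sub>2 - A\<^sub>2) \<le> 4 * sqrt (norm_tr (commutator U\<^sub>1 U\<^sub>2) / L)"
proof -
  obtain V \<mu> where unitary_V: "unitary_matrix V" and U\<^sub>1_eq: "U\<^sub>1 = conjugate_by V (cdiag \<mu>)"
    using unitary_matrix_imp_normal[OF unitary_U(1)] by (rule normal_matrix_unitarily_diagonalizable)
  define W where "W = conjugate_by (conj_transpose V) U\<^sub>2"
  have U\<^sub>2_eq: "U\<^sub>2 = conjugate_by V W"
    by (simp add: W_def conjugate_by_conj_transpose_cancel unitary_V)
  note transport = commutator_conjugate_by[OF unitary_V] norm_tr_conjugate_by[OF unitary_V]
    unitary_matrix_conjugate_by_iff[OF unitary_V] conjugate_by_eq_0_iff[OF unitary_V]
  have "unitary_matrix W" "commutator (cdiag \<mu>) W \<noteq> 0"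
    using unitary_U(2) noncomm by (simp_all add: U\<^sub>1_eq U\<^sub>2_eq transport)
  then obtain a A where range_a: "range a \<subseteq> range \<mu>"
    and A_props: "unitary_matrix A" "commutator (cdiag a) A = 0" "norm_tr (cdiag \<mu> - cdiag a) \<le> 2 * L"
      "norm_tr (W - A) \<le> 4 * sqrt (norm_tr (commutator (cdiag \<mu>) W) / L)"
    using exists_commuting_unitary_near_cdiag[OF _ L_pos] by metis
  have "cmod (\<mu> i) = 1" for i
    using unitary_U(1) by (simp add: U\<^sub>1_eq transport unitary_matrix_cdiag_iff)
  then have "unitary_matrix (cdiag a)"
    unfolding unitary_matrix_cdiag_iff using range_a by (metis imageE range_subsetD)
  moreover have "commutator (cdiag a) (cdiag \<mu>) = 0"
    by (simp add: commutator_eq_0_iff cdiag_mult mult.commute)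
  ultimately show ?thesis
    using A_props by (intro exI[of _ "conjugate_by V (cdiag a)"] exI[of _ "conjugate_by V A"])
      (simp add: U\<^sub>1_eq U\<^sub>2_eq transport flip: conjugate_by_diff)
qed

lemma exists_commuting_unitaries_cube_root:
  fixes U\<^sub>1 U\<^sub>2 :: "complex^'n^'n"
  assumes "unitary_matrix U\<^sub>1" "unitary_matrix U\<^sub>2"
  defines "\<epsilon> \<equiv> norm_tr (commutator U\<^sub>1 U\<^sub>2)"
  shows "\<exists>A\<^sub>1 A\<^sub>2. unitary_matrix A\<^sub>1 \<and> unitary_matrix A\<^sub>2 \<and> commutator A\<^sub>1 A\<^sub>2 = 0 \<and>
    commutator A\<^sub>1 U\<^sub>1 = 0 \<and> norm_tr (U\<^sub>1 - A\<^sub>1) \<le> 2 * \<epsilon> powr (1 / 3) \<and>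
    norm_tr (U\<^sub>2 - A\<^sub>2) \<le> 4 * \<epsilon> powr (1 / 3)"
proof (cases "commutator U\<^sub>1 U\<^sub>2 = 0")
  case True
  then show ?thesis
    using assms(1,2) by (intro exI[of _ U\<^sub>1] exI[of _ U\<^sub>2]) (simp add: norm_tr_eq commutator_def)
next
  case False
  then have "\<epsilon> > 0" by (simp add: \<epsilon>_def norm_tr_eq)
  have "\<epsilon> / \<epsilon> powr (1 / 3) = \<epsilon> powr (1 - 1 / 3)"
    using \<open>\<epsilon> > 0\<close> by (subst powr_diff) simp
  also have "\<dots> = (\<epsilon> powr (1 / 3))\<^sup>2"
    using \<open>\<epsilon> > 0\<close> by (simp add: powr_power)
  finally have "sqrt (\<epsilon> / \<epsilon> powr (1 / 3)) = \<epsilon> powr (1 / 3)" by simp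
  then show ?thesis
    using exists_commuting_unitaries_near[OF assms(1,2) _ False, of "\<epsilon> powr (1 / 3)"] \<open>\<epsilon> > 0\<close>
    by (simp flip: \<epsilon>_def)
qed

theorem theorem1:
  fixes U\<^sub>1 U\<^sub>2 :: "complex^'n^'n"
  assumes "unitary_matrix U\<^sub>1" and "unitary_matrix U\<^sub>2"
  shows "\<exists>A\<^sub>1 A\<^sub>2 :: complex^'n^'n.
    unitary_matrix A\<^sub>1 \<and> unitary_matrix A\<^sub>2 \<and>
    commutator A\<^sub>1 A\<^sub>2 = 0 \<and>
    norm_tr (U\<^sub>1 - A\<^sub>1) \<le> 30 * norm_tr (commutator U\<^sub>1 U\<^sub>2) powr (1 / 9) \<and>
    norm_tr (U\<^sub>2 - A\<^sub>2) \<le> 30 * norm_tr (commutator U\<^sub>1 U\<^sub>2) powr (1 / 9) \<and>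
    commutator A\<^sub>1 U\<^sub>1 = 0"
proof -
  define \<epsilon> where "\<epsilon> = norm_tr (commutator U\<^sub>1 U\<^sub>2)"
  have \<epsilon>_bounds: "0 \<le> \<epsilon>" "\<epsilon> \<le> 2"
    using norm_tr_commutator_unitary_le[OF assms] by (simp_all add: \<epsilon>_def norm_tr_eq)
  have "\<epsilon> powr (1 / 3) = \<epsilon> powr (2 / 9) * \<epsilon> powr (1 / 9)"
    by (simp flip: powr_add)
  also have "\<epsilon> powr (2 / 9) \<le> 2 powr 1"
    using \<epsilon>_bounds powr_mono2[of "2 / 9" \<epsilon> 2] powr_mono[of "2 / 9" 1 "2 :: real"] by linarith
  finally have "\<epsilon> powr (1 / 3) \<le> 2 * \<epsilon> powr (1 / 9)"
    by (simp add: mult_right_mono)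
  then have "2 * \<epsilon> powr (1 / 3) \<le> 30 * \<epsilon> powr (1 / 9)" "4 * \<epsilon> powr (1 / 3) \<le> 30 * \<epsilon> powr (1 / 9)"
    using powr_ge_zero[of \<epsilon> "1 / 9"] by linarith+
  then show ?thesis
    using exists_commuting_unitaries_cube_root[OF assms] unfolding \<epsilon>_def by (meson order_trans)
qed

end
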